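(* Let $A\in\mathbb{R}^{m\times n}$, $b\in\mathbb{R}^m$, $\alpha>0$, and for $z\ge0$ let $$\mathcal{D}(z):=\{X\in\mathcal{S}^n:\ X=\operatorname{Diag}(\operatorname{diag}(X)),\ \operatorname{rank}(X)\le k,\ \|X\|_F^2\le z\}.$$ Consider the problem (Sparse Ridge Regression-R) $$V_{\rm rel}:=\min_{z\in\mathbb{R}_+,\ y\in\mathbb{R}^m,\ X\in\operatorname{conv}(\mathcal{D}(z))}\Big\{\tfrac1n\|y\|_2^2+\alpha z:\ A\operatorname{diag}(X)=b-y\Big\}.$$ Then there is an optimal solution $(X^*,y^*,z^* )$ of Sparse Ridge Regression-R such that $X^*$ has rank at most $k+\operatorname{rank}(A)$.
   Context: $k\le n$ and $m$ are positive integers; $\mathcal{S}^n$ is the space of $n\times n$ real symmetric matrices; $\operatorname{diag}(X)\in\mathbb{R}^n$ is the vector of diagonal entries of $X$, and $\operatorname{Diag}(x)$ is the diagonal matrix with diagonal $x$; $\|\cdot\|_F$ is the Frobenius norm; $\operatorname{conv}$ denotes convex hull. *)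

theory Defs
  imports "HOL-Analysis.Analysis"
begin

definition diag_vec :: "real ^ 'n ^ 'n \<Rightarrow> real ^ 'n" where
  "diag_vec X = (\<chi> i. X $ i $ i)"

definition diag_mat :: "real ^ 'n \<Rightarrow> real ^ 'n ^ 'n" where
  "diag_mat x = (\<chi> i j. if i = j then x $ i else 0)"

text \<open>The library norm on \<^typ>\<open>real ^ 'n ^ 'm\<close> is the Frobenius norm, not the operator norm.\<close>

lemma norm_matrix_eq_Frobenius:
  fixes X :: "real ^ 'n ^ 'm"
  shows "norm X = sqrt (\<Sum>i\<in>UNIV. \<Sum>j\<in>UNIV. (X $ i $ j)\<^sup>2)"
  by (simp add: norm_vec_def L2_set_def sum_nonneg)

definition sparse_diag_set :: "nat \<Rightarrow> real \<Rightarrow> (real ^ 'n ^ 'n) set" where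
  "sparse_diag_set k z =
     {X. transpose X = X \<and> X = diag_mat (diag_vec X) \<and> rank X \<le> k \<and> (norm X)\<^sup>2 \<le> z}"

definition srr_feasible ::
  "real ^ 'n ^ 'm \<Rightarrow> real ^ 'm \<Rightarrow> nat \<Rightarrow> (real ^ 'n ^ 'n) \<times> (real ^ 'm) \<times> real \<Rightarrow> bool" where
  "srr_feasible A b k = (\<lambda>(X, y, z).
     0 \<le> z \<and> X \<in> convex hull (sparse_diag_set k z) \<and> A *v diag_vec X = b - y)"

definition srr_objective ::
  "real \<Rightarrow> (real ^ 'n ^ 'n) \<times> (real ^ 'm) \<times> real \<Rightarrow> real" where
  "srr_objective \<alpha> = (\<lambda>(X, y, z). 1 / real CARD('n) * (norm y)\<^sup>2 + \<alpha> * z)"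

text \<open>Optimality is the library's \<^const>\<open>is_arg_min\<close>: the point is feasible and no feasible point
  has a strictly smaller objective value.\<close>

definition srr_optimal ::
  "real ^ 'n ^ 'm \<Rightarrow> real ^ 'm \<Rightarrow> nat \<Rightarrow> real \<Rightarrow> (real ^ 'n ^ 'n) \<times> (real ^ 'm) \<times> real \<Rightarrow> bool" where
  "srr_optimal A b k \<alpha> = is_arg_min (srr_objective \<alpha>) (srr_feasible A b k)"

end

theory Submission
  imports Defs
begin

text \<open>
  Identify a diagonal matrix with its diagonal \<open>x\<close>; rank becomes the number of nonzero entries,
  and the feasible \<open>x\<close> form the convex hull \<open>C(z)\<close> of the \<open>k\<close>-sparse vectors in the ball of
  squared radius \<open>z\<close>. The proof rests on a description of \<open>C(z)\<close> by weights: \<open>x\<close> lies in \<open>C(z)\<close>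
  iff there is \<open>w\<close> in the capped simplex
  \<open>{w. 0 \<le> w\<^sub>i \<le> 1, \<Sum> w\<^sub>i \<le> k}\<close> with \<open>\<Sum> x\<^sub>i\<^sup>2 / w\<^sub>i \<le> z\<close>, where \<open>w\<^sub>i = 0\<close> is allowed
  only if \<open>x\<^sub>i = 0\<close> and then contributes 0. The weight \<open>w\<^sub>i\<close> measures how much of
  the convex combination uses the coordinate \<open>i\<close>.

  Write \<open>x\<^sub>i = w\<^sub>i g\<^sub>i\<close> and freeze the slopes \<open>g\<close>. Then both \<open>x\<close> and the cost \<open>\<Sum> w\<^sub>i g\<^sub>i\<^sup>2\<close> are
  linear in \<open>w\<close>, so lowering the cost while keeping \<open>A x\<close> fixed is a linear program over a slice of
  the capped simplex. It has a solution at a vertex, and counting dimensions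
  (\<open>extreme_point_support\<close>) shows that a vertex has at most \<open>k + rank A\<close> nonzero weights:
  at most \<open>rank A + 1\<close> weights are strictly between 0 and 1, and if there is such a weight then at
  most \<open>k - 1\<close> weights equal 1. Since \<open>A x\<close> does not change and the cost does not grow, the same
  \<open>y\<close> and \<open>z\<close> remain feasible, so any optimal solution can be replaced by one of small rank.

  The same count with no linear constraint shows that the capped simplex is the convex hull of its
  \<open>k\<close>-sparse points, and this is what turns weights back into a convex combination of
  \<open>k\<close>-sparse vectors (\<open>weighted_in_hull_sparse_ball\<close>).

  Existence of an optimal solution comes from the weight description as well. In the form
  \<open>x\<^sub>i\<^sup>2 \<le> w\<^sub>i q\<^sub>i\<close>, \<open>\<Sum> q\<^sub>i \<le> z\<close> it defines a compact convex set of triples \<open>(w, q, x)\<close>, and \<open>z\<close> may be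
  bounded because the zero matrix is feasible.
\<close>

section \<open>Reduction from diagonal matrices to vectors\<close>

definition sparse_ball :: "nat \<Rightarrow> real \<Rightarrow> (real ^ 'n) set" where
  "sparse_ball k z = {x. card {i. x $ i \<noteq> 0} \<le> k \<and> (norm x)\<^sup>2 \<le> z}"

lemma zero_in_sparse_ball: "0 \<le> z \<Longrightarrow> 0 \<in> sparse_ball k z"
  by (simp add: sparse_ball_def)

lemma norm_vec_power2: "(norm (x :: real ^ 'n))\<^sup>2 = (\<Sum>i\<in>UNIV. (x $ i)\<^sup>2)"
  by (simp add: norm_vec_def L2_set_def sum_nonneg)

lemma linear_diag_mat: "linear diag_mat"
  by (rule linearI) (auto simp: diag_mat_def vec_eq_iff)

lemma diag_vec_diag_mat [simp]: "diag_vec (diag_mat x) = x"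
  by (simp add: diag_vec_def diag_mat_def vec_eq_iff)

lemma transpose_diag_mat [simp]: "transpose (diag_mat x) = diag_mat x"
  by (simp add: transpose_def diag_mat_def vec_eq_iff)

lemma diag_mat_mult_vec: "diag_mat x *v u = x * u"
  by (simp add: diag_mat_def matrix_vector_mult_def vec_eq_iff if_distrib[of "\<lambda>t. t * _"] cong: if_cong)

lemma norm_diag_mat [simp]: "norm (diag_mat x) = norm x"
  unfolding norm_matrix_eq_Frobenius
  by (simp add: diag_mat_def norm_vec_def L2_set_def if_distrib[of "\<lambda>t. t\<^sup>2"] cong: if_cong)

lemma dim_coordinate_subspace:
  "dim {x :: real ^ 'n. \<forall>i. i \<notin> I \<longrightarrow> x $ i = 0} = card I"
  using dim_substandard_cart[of I, where ?'a = real] by (simp add: dim_vec_eq)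

lemma rank_diag_mat: "rank (diag_mat (x :: real ^ 'n)) = card {i. x $ i \<noteq> 0}"
proof -
  have "range (\<lambda>u. diag_mat x *v u) = {v :: real ^ 'n. \<forall>i. i \<notin> {i. x $ i \<noteq> 0} \<longrightarrow> v $ i = 0}"
  proof (intro equalityI subsetI)
    fix v :: "real ^ 'n" assume v: "v \<in> {v. \<forall>i. i \<notin> {i. x $ i \<noteq> 0} \<longrightarrow> v $ i = 0}"
    have "v = diag_mat x *v (\<chi> i. v $ i / x $ i)"
      using v by (auto simp: diag_mat_mult_vec vec_eq_iff)
    then show "v \<in> range (\<lambda>u. diag_mat x *v u)" by blast
  qed (auto simp: diag_mat_mult_vec)
  then show ?thesis
    by (simp only: rank_dim_range dim_coordinate_subspace)
qed

lemma sparse_diag_set_eq: "sparse_diag_set k z = diag_mat ` sparse_ball k z"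
proof (intro equalityI subsetI)
  fix X :: "real ^ 'a ^ 'a" assume X: "X \<in> sparse_diag_set k z"
  then have eq: "X = diag_mat (diag_vec X)"
    by (simp add: sparse_diag_set_def)
  then have "rank X = card {i. diag_vec X $ i \<noteq> 0}" "norm X = norm (diag_vec X)"
    by (metis rank_diag_mat, metis norm_diag_mat)
  then have "diag_vec X \<in> sparse_ball k z"
    using X by (simp add: sparse_diag_set_def sparse_ball_def)
  then show "X \<in> diag_mat ` sparse_ball k z" using eq by blast
qed (auto simp: sparse_diag_set_def sparse_ball_def rank_diag_mat)

lemma convex_hull_sparse_diag_set:
  "convex hull sparse_diag_set k z = diag_mat ` (convex hull sparse_ball k z)"
  by (simp add: sparse_diag_set_eq convex_hull_linear_image[OF linear_diag_mat])

section \<open>Vertices of sliced capped simplices are sparse\<close>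

definition capped_simplex :: "nat \<Rightarrow> (real ^ 'n) set" where
  "capped_simplex k = {w. (\<forall>i. 0 \<le> w $ i \<and> w $ i \<le> 1) \<and> (\<Sum>i\<in>UNIV. w $ i) \<le> real k}"
lemma capped_simplex_bounds:
  assumes "w \<in> capped_simplex k" shows "0 \<le> w $ i" "w $ i \<le> 1"
  using assms by (auto simp: capped_simplex_def)

lemma capped_simplex_cbox: "capped_simplex k \<subseteq> cbox 0 1"
  by (auto simp: capped_simplex_def mem_box_cart)

lemma closed_capped_simplex: "closed (capped_simplex k)"
proof -
  have "capped_simplex k = (\<Inter>i. {w :: real ^ 'a. 0 \<le> w $ i} \<inter> {w. w $ i \<le> 1})
      \<inter> {w. (\<Sum>i\<in>UNIV. w $ i) \<le> real k}"
    by (auto simp: capped_simplex_def)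
  also have "closed \<dots>"
    by (intro closed_INT closed_Int ballI closed_Collect_le continuous_intros)
  finally show ?thesis .
qed

lemma compact_capped_simplex: "compact (capped_simplex k)"
  using closed_capped_simplex capped_simplex_cbox
  by (meson bounded_cbox bounded_subset compact_eq_bounded_closed)

lemma convex_capped_simplex: "convex (capped_simplex k :: (real ^ 'n) set)"
proof (rule convexI)
  fix v w :: "real ^ 'n" and s t :: real
  assume v: "v \<in> capped_simplex k" and w: "w \<in> capped_simplex k"
    and st: "0 \<le> s" "0 \<le> t" "s + t = 1"
  have "(\<Sum>i\<in>UNIV. (s *\<^sub>R v + t *\<^sub>R w) $ i) = s * (\<Sum>i\<in>UNIV. v $ i) + t * (\<Sum>i\<in>UNIV. w $ i)"
    by (simp add: sum.distrib sum_distrib_left)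
  also have "\<dots> \<le> real k"
    using v w st by (intro convex_bound_le) (auto simp: capped_simplex_def)
  finally show "s *\<^sub>R v + t *\<^sub>R w \<in> capped_simplex k"
    using v w st by (auto simp: capped_simplex_def intro!: convex_bound_le)
qed

text \<open>
  A direction of zero sum that touches only weights strictly inside \<open>(0, 1)\<close> can be followed both
  ways for a while, so a point with such a direction available is not a vertex.
\<close>
lemma capped_simplex_perturb:
  fixes w d :: "real ^ 'n"
  assumes w: "w \<in> capped_simplex k"
    and d: "d \<noteq> 0" "(\<Sum>i\<in>UNIV. d $ i) = 0"
    and supp: "\<And>i. d $ i \<noteq> 0 \<Longrightarrow> 0 < w $ i \<and> w $ i < 1"
  obtains e where "e > 0" "w + e *\<^sub>R d \<in> capped_simplex k" "w - e *\<^sub>R d \<in> capped_simplex k"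
proof -
  define F where "F = {i. 0 < w $ i \<and> w $ i < 1}"
  define m where "m = Min ((\<lambda>i. min (w $ i) (1 - w $ i)) ` F)"
  have "F \<noteq> {}"
    using d(1) supp by (auto simp: F_def vec_eq_iff)
  then have "m > 0"
    unfolding m_def by (auto simp: F_def)
  moreover have "m \<le> min (w $ i) (1 - w $ i)" if "i \<in> F" for i
    unfolding m_def using that by (intro Min_le) auto
  ultimately have m: "m > 0" "\<And>i. i \<in> F \<Longrightarrow> m \<le> w $ i \<and> m \<le> 1 - w $ i"
    by auto
  define e where "e = m / norm d"
  have e: "e > 0" using m d(1) by (simp add: e_def)
  have small: "\<bar>e * d $ i\<bar> \<le> m" for i
  proof -
    have "e * \<bar>d $ i\<bar> \<le> e * norm d"
      using e component_le_norm_cart[of d i] by simp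
    then show ?thesis using e d(1) m(1) by (simp add: e_def abs_mult)
  qed
  have box: "0 \<le> w $ i + s * d $ i \<and> w $ i + s * d $ i \<le> 1" if "s = e \<or> s = - e" for s i
  proof (cases "d $ i = 0")
    case True
    then show ?thesis using capped_simplex_bounds[OF w] by simp
  next
    case False
    then have "m \<le> w $ i \<and> m \<le> 1 - w $ i" using supp m(2) by (simp add: F_def)
    then show ?thesis using small[of i] that by (auto simp: abs_le_iff)
  qed
  have sums: "(\<Sum>i\<in>UNIV. w $ i + s * d $ i) \<le> real k" for s
    using w d(2) by (simp add: capped_simplex_def sum.distrib flip: sum_distrib_left)
  have "w + s *\<^sub>R d \<in> capped_simplex k" if "s = e \<or> s = - e" for s
    using box[OF that] sums[of s] by (simp add: capped_simplex_def)
  from this[of e] this[of "- e"] e that show thesis by simp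
qed

text \<open>
  Directions supported on the fractional weights form a space of dimension equal to the number of
  those weights. If this exceeded \<open>dim (range L) + 1\<close>, some nonzero direction would be killed by
  both \<open>L\<close> and the coordinate sum and could be followed both ways. The extra 1 is paid for by the cap
  on the sum: as soon as one weight is fractional, the weights equal to 1 are fewer than \<open>k\<close>.
\<close>
lemma extreme_point_support:
  fixes L :: "real ^ 'n \<Rightarrow> 'b::euclidean_space"
  assumes L: "linear L"
    and ext: "w extreme_point_of (capped_simplex k \<inter> {v. L v = c})"
  shows "card {i. w $ i \<noteq> 0} \<le> k + dim (range L)"
proof -
  define F where "F = {i. 0 < w $ i \<and> w $ i < 1}"
  define ones where "ones = {i. w $ i = 1}"
  have w: "w \<in> capped_simplex k" and Lw: "L w = c"
    using ext by (auto simp: extreme_point_of_def)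
  have supp: "{i. w $ i \<noteq> 0} = ones \<union> F" and disj: "ones \<inter> F = {}"
    using capped_simplex_bounds[OF w] by (auto simp: ones_def F_def less_le)
  have card_supp: "card {i. w $ i \<noteq> 0} = card ones + card F"
    unfolding supp by (intro card_Un_disjoint disj) auto
  have "real (card ones) + (\<Sum>i\<in>F. w $ i) = (\<Sum>i\<in>ones \<union> F. w $ i)"
    using disj by (subst sum.union_disjoint) (auto simp: ones_def)
  also have "\<dots> = (\<Sum>i\<in>UNIV. w $ i)"
    by (rule sum.mono_neutral_left) (auto simp flip: supp)
  finally have weight: "real (card ones) + (\<Sum>i\<in>F. w $ i) \<le> real k"
    using w by (simp add: capped_simplex_def)
  show ?thesis
  proof (cases "F = {}")
    case True
    then show ?thesis using weight card_supp by simp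
  next
    case False
    then have "(\<Sum>i\<in>F. w $ i) > 0"
      by (intro sum_pos) (auto simp: F_def)
    with weight have "card ones < k" by simp
    \<comment> \<open>The coordinate sum is treated as one more linear constraint next to \<open>L\<close>.\<close>
    let ?V = "{d :: real ^ 'n. \<forall>i. i \<notin> F \<longrightarrow> d $ i = 0}"
    let ?T = "\<lambda>d :: real ^ 'n. (L d, \<Sum>i\<in>UNIV. d $ i)"
    have linT: "linear ?T"
      by (rule linearI)
        (simp_all add: linear_add[OF L] linear_scale[OF L] sum.distrib sum_distrib_left)
    have subV: "subspace ?V"
      by (auto simp: subspace_def)
    have "d = 0" if d: "d \<in> ?V" "?T d = 0" for d
    proof (rule ccontr)
      assume nz: "d \<noteq> 0"
      have "L d = 0" "(\<Sum>i\<in>UNIV. d $ i) = 0" using d(2) by (simp_all add: zero_prod_def)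
      moreover have "\<And>i. d $ i \<noteq> 0 \<Longrightarrow> 0 < w $ i \<and> w $ i < 1"
        using d(1) by (auto simp: F_def)
      ultimately obtain e where e: "e > 0" "w + e *\<^sub>R d \<in> capped_simplex k"
          "w - e *\<^sub>R d \<in> capped_simplex k"
        using capped_simplex_perturb[OF w nz] by blast
      have "L (w + e *\<^sub>R d) = c" "L (w - e *\<^sub>R d) = c"
        using Lw \<open>L d = 0\<close> by (simp_all add: linear_add[OF L] linear_diff[OF L] linear_scale[OF L])
      moreover have "w \<in> open_segment (w + e *\<^sub>R d) (w - e *\<^sub>R d)"
      proof -
        have "midpoint (w + e *\<^sub>R d) (w - e *\<^sub>R d) = w"
          by (simp add: midpoint_def flip: scaleR_2)
        moreover have "w + e *\<^sub>R d \<noteq> w - e *\<^sub>R d"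
          using e(1) nz by (auto simp: vec_eq_iff)
        ultimately show ?thesis by (metis midpoint_in_open_segment)
      qed
      ultimately show False using ext e by (auto simp: extreme_point_of_def)
    qed
    then have "inj_on ?T ?V"
      using linear_inj_on_iff_eq_0[OF linT subV] by blast
    then have "card F = dim (?T ` ?V)"
      using dim_image_eq[OF linT] subV by (simp add: span_eq_iff[THEN iffD2] dim_coordinate_subspace)
    also have "\<dots> \<le> dim (range L \<times> (UNIV :: real set))"
      by (intro dim_subset) auto
    also have "\<dots> = dim (range L) + 1"
      by (subst dim_Times) (auto intro: linear_subspace_image[OF L])
    finally show ?thesis using \<open>card ones < k\<close> card_supp by simp
  qed
qed

text \<open>
  The point \<open>w\<close> is a convex combination of vertices of the slice \<open>{v. L v = L w}\<close> of the capped
  simplex, so the linear function \<open>f\<close> cannot exceed \<open>f w\<close> at all of them.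
\<close>
lemma sparse_solution_of_program:
  fixes L :: "real ^ 'n \<Rightarrow> 'b::euclidean_space" and f :: "real ^ 'n \<Rightarrow> real"
  assumes L: "linear L" and f: "linear f" and w: "w \<in> capped_simplex k"
  obtains v where "v \<in> capped_simplex k" "L v = L w" "f v \<le> f w"
    "card {i. v $ i \<noteq> 0} \<le> k + dim (range L)"
proof -
  define K where "K = capped_simplex k \<inter> {v. L v = L w}"
  have "closed {v. L v = L w}"
    using linear_continuous_on[OF linear_conv_bounded_linear[THEN iffD1, OF L]]
    by (intro closed_Collect_eq continuous_intros) auto
  then have "compact K"
    unfolding K_def by (intro compact_Int_closed compact_capped_simplex)
  moreover have "convex {v. L v = L w}"
    using convex_linear_vimage[OF L, of "{L w}"] by (simp add: vimage_def)
  then have "convex K"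
    unfolding K_def by (intro convex_Int convex_capped_simplex)
  ultimately have K: "K = convex hull {v. v extreme_point_of K}"
    by (rule Krein_Milman_Minkowski)
  have "\<exists>v. v extreme_point_of K \<and> f v \<le> f w"
  proof (rule ccontr)
    assume "\<not> ?thesis"
    then have "{v. v extreme_point_of K} \<subseteq> f -` {f w<..}" by force
    moreover have "convex (f -` {f w<..})"
      by (rule convex_linear_vimage[OF f]) simp
    ultimately have "convex hull {v. v extreme_point_of K} \<subseteq> f -` {f w<..}"
      by (rule hull_minimal)
    with K have "K \<subseteq> f -` {f w<..}" by simp
    moreover have "w \<in> K" using w by (simp add: K_def)
    ultimately show False by auto
  qed
  then obtain v where v: "v extreme_point_of K" "f v \<le> f w" by blast
  then have "v \<in> K" by (simp add: extreme_point_of_def)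
  then show thesis
    using that v extreme_point_support[OF L, of v k "L w"] by (auto simp: K_def)
qed

text \<open>
  For \<open>L = 0\<close> the count says that every vertex of the capped simplex is \<open>k\<close>-sparse. A
  convex decomposition of weights into such vertices is what yields \<open>k\<close>-sparse vectors.
\<close>
lemma capped_simplex_subset_hull_sparse:
  "capped_simplex k \<subseteq> convex hull {v \<in> capped_simplex k. card {i. v $ i \<noteq> 0} \<le> k}"
proof -
  have "card {i. v $ i \<noteq> 0} \<le> k" if "v extreme_point_of capped_simplex k" for v :: "real ^ 'a"
    using extreme_point_support[OF linear_zero[where ?'b = real], of v k 0] that
    by (simp add: image_constant_conv)
  then have "{v :: real ^ 'a. v extreme_point_of capped_simplex k}
      \<subseteq> {v \<in> capped_simplex k. card {i. v $ i \<noteq> 0} \<le> k}"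
    by (auto simp: extreme_point_of_def)
  from hull_mono[OF this] show ?thesis
    using Krein_Milman_Minkowski[OF compact_capped_simplex convex_capped_simplex] by blast
qed

section \<open>Weights certify membership in the convex hull\<close>

lemma linear_times_right: "linear (\<lambda>w :: real ^ 'n. w * g)"
  by (rule linearI) (simp_all add: vec_eq_iff algebra_simps)

definition weighted_square :: "real ^ 'n \<Rightarrow> real ^ 'n \<Rightarrow> real" where
  "weighted_square g w = (\<Sum>i\<in>UNIV. w $ i * (g $ i)\<^sup>2)"

lemma linear_weighted_square: "linear (weighted_square g)"
  by (rule linearI)
    (simp_all add: weighted_square_def sum_distrib_left algebra_simps sum.distrib)

lemma weighted_square_nonneg:
  "w \<in> capped_simplex k \<Longrightarrow> 0 \<le> weighted_square g w"
  by (auto simp: weighted_square_def capped_simplex_def intro!: sum_nonneg)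

text \<open>
  The set \<open>{(r, y). 0 < r \<and> y / r \<in> C}\<close> is the cone over \<open>C\<close>, which is convex; this is its preimage
  under the affine map \<open>s \<mapsto> (t s + c, f s)\<close>.
\<close>
lemma convex_scaled_preimage:
  fixes f :: "'a::real_vector \<Rightarrow> 'b::real_vector" and t :: "'a \<Rightarrow> real"
  assumes f: "linear f" and t: "linear t" and C: "convex C"
  shows "convex {s. 0 < t s + c \<and> (1 / (t s + c)) *\<^sub>R f s \<in> C}"
proof (rule convexI)
  fix x y :: 'a and a b :: real
  assume x: "x \<in> {s. 0 < t s + c \<and> (1 / (t s + c)) *\<^sub>R f s \<in> C}"
    and y: "y \<in> {s. 0 < t s + c \<and> (1 / (t s + c)) *\<^sub>R f s \<in> C}"
    and ab: "0 \<le> a" "0 \<le> b" "a + b = 1"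
  define p q r where "p = t x + c" and "q = t y + c" and "r = t (a *\<^sub>R x + b *\<^sub>R y) + c"
  have pq: "p > 0" "q > 0" using x y by (auto simp: p_def q_def)
  have "c = a * c + b * c" using ab by (simp flip: distrib_right)
  then have r: "r = a * p + b * q"
    by (simp add: r_def p_def q_def linear_add[OF t] linear_scale[OF t] algebra_simps)
  have "r > 0"
    unfolding r using pq ab by (smt (verit) mult_nonneg_nonneg mult_pos_pos)
  have "(a * p / r) *\<^sub>R (1 / p) *\<^sub>R f x + (b * q / r) *\<^sub>R (1 / q) *\<^sub>R f y \<in> C"
    using x y ab pq \<open>r > 0\<close>
    by (intro convexD[OF C]) (auto simp: p_def[symmetric] q_def[symmetric] r simp flip: add_divide_distrib)
  also have "(a * p / r) *\<^sub>R (1 / p) *\<^sub>R f x + (b * q / r) *\<^sub>R (1 / q) *\<^sub>R f y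
      = (1 / r) *\<^sub>R f (a *\<^sub>R x + b *\<^sub>R y)"
    using pq by (simp add: linear_add[OF f] linear_scale[OF f] algebra_simps)
  finally show "a *\<^sub>R x + b *\<^sub>R y \<in> {s. 0 < t s + c \<and> (1 / (t s + c)) *\<^sub>R f s \<in> C}"
    using \<open>r > 0\<close> by (simp add: r_def)
qed

text \<open>
  If \<open>w\<close> is a convex combination of \<open>k\<close>-sparse weights \<open>s\<close>, then \<open>w * g\<close> is the same combination of
  the \<open>k\<close>-sparse vectors \<open>s * g\<close>. Their squared norms are at most \<open>z\<close> only on average, so they have
  to be rescaled individually. By the inequality between arithmetic and geometric means the norm of
  \<open>s * g\<close> is at most \<open>\<tau> s\<close> times the square root of \<open>z\<close>, where \<open>\<tau> s = (weighted_square g s / z + 1) / 2\<close>.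
  As \<open>\<tau>\<close> is affine, the property "\<open>s * g\<close> lies in \<open>\<tau> s\<close> times the hull" passes to convex
  combinations, and \<open>\<tau> w \<le> 1\<close>.
\<close>
lemma weighted_in_hull_sparse_ball:
  fixes w g :: "real ^ 'n"
  assumes w: "w \<in> capped_simplex k" and z: "weighted_square g w \<le> z"
  shows "w * g \<in> convex hull sparse_ball k z"
proof -
  have "0 \<le> z" using weighted_square_nonneg[OF w] z by (rule order_trans)
  show ?thesis
  proof (cases "z = 0")
    case True
    then have "weighted_square g w = 0"
      using weighted_square_nonneg[OF w, of g] z by simp
    then have "\<forall>i. w $ i * (g $ i)\<^sup>2 = 0"
      unfolding weighted_square_def using capped_simplex_bounds[OF w]
      by (subst (asm) sum_nonneg_eq_0_iff) auto
    then have "w * g = 0" by (auto simp: vec_eq_iff)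
    then show ?thesis using hull_inc[OF zero_in_sparse_ball[OF \<open>0 \<le> z\<close>], of convex k] by simp
  next
    case False
    then have "z > 0" using \<open>0 \<le> z\<close> by simp
    define \<tau> where "\<tau> s = weighted_square g s / (2 * z) + 1 / 2" for s
    let ?C = "convex hull sparse_ball k z"
    let ?G = "{s. 0 < \<tau> s \<and> (1 / \<tau> s) *\<^sub>R (s * g) \<in> ?C}"
    have "linear (\<lambda>s. weighted_square g s / (2 * z))"
      using linear_compose_scale_right[OF linear_weighted_square, of "1 / (2 * z)" g] by simp
    from convex_scaled_preimage[OF linear_times_right this convex_convex_hull]
    have "convex ?G" unfolding \<tau>_def .
    moreover have "{v \<in> capped_simplex k. card {i. v $ i \<noteq> 0} \<le> k} \<subseteq> ?G"
    proof (intro subsetI, clarify)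
      fix v :: "real ^ 'n"
      assume v: "v \<in> capped_simplex k" "card {i. v $ i \<noteq> 0} \<le> k"
      have pos: "\<tau> v > 0"
        using weighted_square_nonneg[OF v(1), of g] \<open>z > 0\<close> by (simp add: \<tau>_def add_nonneg_pos)
      have "(norm (v * g))\<^sup>2 \<le> weighted_square g v"
        unfolding norm_vec_power2 weighted_square_def
      proof (rule sum_mono)
        fix i
        \<comment> \<open>Weights lie in the unit interval, so squaring them only helps.\<close>
        have "(v $ i)\<^sup>2 \<le> v $ i"
          using capped_simplex_bounds[OF v(1), of i] by (simp add: power2_eq_square mult_left_le)
        then show "((v * g) $ i)\<^sup>2 \<le> v $ i * (g $ i)\<^sup>2"
          by (simp add: power_mult_distrib mult_right_mono)
      qed
      also have "\<dots> = z * (2 * \<tau> v - 1)"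
        using \<open>z > 0\<close> by (simp add: \<tau>_def field_simps)
      also have "\<dots> \<le> z * (\<tau> v)\<^sup>2"
        using \<open>z > 0\<close> zero_le_power2[of "\<tau> v - 1"]
        by (intro mult_left_mono) (simp_all add: power2_eq_square algebra_simps)
      finally have "(norm ((1 / \<tau> v) *\<^sub>R (v * g)))\<^sup>2 \<le> z"
        using pos by (simp add: power_divide field_simps)
      moreover have "card {i. ((1 / \<tau> v) *\<^sub>R (v * g)) $ i \<noteq> 0} \<le> k"
        using v(2) by (rule order_trans[rotated]) (auto intro!: card_mono)
      ultimately have "(1 / \<tau> v) *\<^sub>R (v * g) \<in> sparse_ball k z"
        by (simp add: sparse_ball_def)
      then show "0 < \<tau> v \<and> (1 / \<tau> v) *\<^sub>R (v * g) \<in> ?C"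
        using pos by (blast intro: hull_inc)
    qed
    ultimately have "w \<in> ?G"
      using capped_simplex_subset_hull_sparse[of k] w hull_minimal by blast
    then have \<tau>w: "0 < \<tau> w" and mem: "(1 / \<tau> w) *\<^sub>R (w * g) \<in> ?C" by auto
    \<comment> \<open>Shrinking towards 0 removes the factor \<open>\<tau> w\<close>.\<close>
    have "\<tau> w \<le> 1" using z \<open>z > 0\<close> by (simp add: \<tau>_def field_simps)
    then have "\<tau> w *\<^sub>R (1 / \<tau> w) *\<^sub>R (w * g) + (1 - \<tau> w) *\<^sub>R 0 \<in> ?C"
      using \<tau>w mem zero_in_sparse_ball[OF \<open>0 \<le> z\<close>, of k]
      by (intro convexD[OF convex_convex_hull]) (auto intro: hull_inc)
    then show ?thesis using \<tau>w by simp
  qed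
qed

section \<open>Conic description of the convex hull\<close>

text \<open>
  Here \<open>q\<^sub>i\<close> is a budget bounding \<open>x\<^sub>i\<^sup>2 / w\<^sub>i\<close>. The product form forces \<open>x\<^sub>i = 0\<close> where
  \<open>w\<^sub>i = 0\<close> and makes closedness evident.
\<close>
definition conic_lift :: "nat \<Rightarrow> real \<Rightarrow> ((real ^ 'n) \<times> (real ^ 'n) \<times> (real ^ 'n)) set" where
  "conic_lift k z = {(w, q, x). w \<in> capped_simplex k
     \<and> (\<forall>i. 0 \<le> q $ i \<and> (x $ i)\<^sup>2 \<le> w $ i * q $ i) \<and> (\<Sum>i\<in>UNIV. q $ i) \<le> z}"

text \<open>The rotated Lorentz cone \<open>{(a, b, x). 0 \<le> a, 0 \<le> b, x\<^sup>2 \<le> a b}\<close> is convex.\<close>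
lemma rotated_cone_combination:
  fixes x y a b c d s t :: real
  assumes nonneg: "0 \<le> a" "0 \<le> b" "0 \<le> c" "0 \<le> d" "0 \<le> s" "0 \<le> t"
    and x: "x\<^sup>2 \<le> a * b" and y: "y\<^sup>2 \<le> c * d"
  shows "(s * x + t * y)\<^sup>2 \<le> (s * a + t * c) * (s * b + t * d)"
proof -
  have "x\<^sup>2 * y\<^sup>2 \<le> (a * b) * (c * d)"
    using x y nonneg by (intro mult_mono) auto
  then have "(2 * x * y)\<^sup>2 \<le> 4 * ((a * d) * (b * c))"
    by (simp add: power2_eq_square algebra_simps)
  also have "\<dots> \<le> (a * d + b * c)\<^sup>2"
    using zero_le_power2[of "a * d - b * c"] by (simp add: power2_eq_square algebra_simps)
  finally have "2 * x * y \<le> a * d + b * c"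
    by (rule power2_le_imp_le) (use nonneg in auto)
  then have "s * t * (2 * x * y) \<le> s * t * (a * d + b * c)"
    using nonneg by (intro mult_left_mono) auto
  moreover have "s\<^sup>2 * x\<^sup>2 \<le> s\<^sup>2 * (a * b)" "t\<^sup>2 * y\<^sup>2 \<le> t\<^sup>2 * (c * d)"
    using x y by (auto intro: mult_left_mono)
  ultimately show ?thesis
    by (simp add: power2_eq_square algebra_simps)
qed

lemma convex_conic_lift: "convex (conic_lift k z :: ((real ^ 'n) \<times> (real ^ 'n) \<times> (real ^ 'n)) set)"
proof (rule convexI)
  fix u v :: "(real ^ 'n) \<times> (real ^ 'n) \<times> (real ^ 'n)" and s t :: real
  assume u: "u \<in> conic_lift k z" and v: "v \<in> conic_lift k z"
    and st: "0 \<le> s" "0 \<le> t" "s + t = 1"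
  obtain w q x w' q' x' where [simp]: "u = (w, q, x)" "v = (w', q', x')"
    by (metis prod_cases3)
  have ww: "w \<in> capped_simplex k" "w' \<in> capped_simplex k"
    and q: "\<And>i. 0 \<le> q $ i" "\<And>i. 0 \<le> q' $ i"
    and x: "\<And>i. (x $ i)\<^sup>2 \<le> w $ i * q $ i" "\<And>i. (x' $ i)\<^sup>2 \<le> w' $ i * q' $ i"
    and sq: "(\<Sum>i\<in>UNIV. q $ i) \<le> z" "(\<Sum>i\<in>UNIV. q' $ i) \<le> z"
    using u v by (auto simp: conic_lift_def)
  have "(\<Sum>i\<in>UNIV. s * q $ i + t * q' $ i) = s * (\<Sum>i\<in>UNIV. q $ i) + t * (\<Sum>i\<in>UNIV. q' $ i)"
    by (simp add: sum.distrib sum_distrib_left)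
  also have "\<dots> \<le> z" using sq st by (intro convex_bound_le)
  finally have "(\<Sum>i\<in>UNIV. s * q $ i + t * q' $ i) \<le> z" .
  moreover have "s *\<^sub>R w + t *\<^sub>R w' \<in> capped_simplex k"
    using ww st by (intro convexD[OF convex_capped_simplex])
  moreover have "(s * x $ i + t * x' $ i)\<^sup>2
      \<le> (s * w $ i + t * w' $ i) * (s * q $ i + t * q' $ i)" for i
    by (rule rotated_cone_combination)
      (use capped_simplex_bounds[OF ww(1)] capped_simplex_bounds[OF ww(2)] q x st in auto)
  ultimately show "s *\<^sub>R u + t *\<^sub>R v \<in> conic_lift k z"
    using q st by (simp add: conic_lift_def)
qed

lemma compact_conic_lift: "compact (conic_lift k z :: ((real ^ 'n) \<times> (real ^ 'n) \<times> (real ^ 'n)) set)"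
proof -
  let ?S = "conic_lift k z :: ((real ^ 'n) \<times> (real ^ 'n) \<times> (real ^ 'n)) set"
  let ?K = "cbox 0 1 \<times> cbox 0 (\<chi> i. z) \<times> cbox (\<chi> i. - (z + 1)) (\<chi> i. z + 1)
    :: ((real ^ 'n) \<times> (real ^ 'n) \<times> (real ^ 'n)) set"
  have "?S = (\<Inter>i. {p. 0 \<le> fst (snd p) $ i}
        \<inter> {p. (snd (snd p) $ i)\<^sup>2 \<le> fst p $ i * fst (snd p) $ i})
      \<inter> {p. (\<Sum>i\<in>UNIV. fst (snd p) $ i) \<le> z} \<inter> fst -` capped_simplex k"
    by (auto simp: conic_lift_def)
  also have "closed \<dots>"
    by (intro closed_INT closed_Int ballI closed_Collect_le continuous_intros
        closed_vimage closed_capped_simplex)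
  finally have "closed ?S" .
  moreover have "?S \<subseteq> ?K"
  proof clarify
    fix w q x :: "real ^ 'n"
    assume "(w, q, x) \<in> ?S"
    then have w: "w \<in> capped_simplex k" and q: "\<And>i. 0 \<le> q $ i"
      and x: "\<And>i. (x $ i)\<^sup>2 \<le> w $ i * q $ i" and sq: "(\<Sum>i\<in>UNIV. q $ i) \<le> z"
      by (auto simp: conic_lift_def)
    have qz: "q $ i \<le> z" for i
      using member_le_sum[of i UNIV "\<lambda>i. q $ i"] q sq by force
    have "\<bar>x $ i\<bar> \<le> z + 1" for i
    proof -
      have z: "0 \<le> z" using q[of i] qz[of i] by simp
      have "(x $ i)\<^sup>2 \<le> w $ i * q $ i" by (rule x)
      also have "\<dots> \<le> 1 * z"
        using capped_simplex_bounds[OF w, of i] q[of i] qz[of i] by (intro mult_mono) auto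
      also have "\<dots> \<le> (z + 1)\<^sup>2"
        using z by (simp add: power2_eq_square algebra_simps)
      finally show ?thesis
        using z abs_le_square_iff[of "x $ i" "z + 1"] by simp
    qed
    then show "w \<in> cbox 0 1 \<and> (q, x) \<in> cbox 0 (\<chi> i. z) \<times> cbox (\<chi> i. - (z + 1)) (\<chi> i. z + 1)"
      using capped_simplex_bounds[OF w] q qz by (auto simp: mem_box_cart abs_le_iff minus_le_iff
        simp del: minus_add_distrib)
  qed
  moreover have "compact ?K"
    by (intro compact_Times compact_cbox)
  ultimately show ?thesis
    using compact_Int_closed[of ?K ?S] by (simp add: inf.absorb2)
qed

text \<open>
  The slope is \<open>g\<^sub>i = x\<^sub>i / w\<^sub>i\<close>; division by zero is harmless because \<open>w\<^sub>i = 0\<close> forces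
  \<open>x\<^sub>i = 0\<close>.
\<close>
lemma conic_lift_slopes:
  assumes "(w, q, x) \<in> conic_lift k z"
  obtains g where "w \<in> capped_simplex k" "x = w * g" "weighted_square g w \<le> z"
proof
  define g where "g = (\<chi> i. x $ i / w $ i)"
  have w: "w \<in> capped_simplex k" and q: "\<And>i. 0 \<le> q $ i"
    and x: "\<And>i. (x $ i)\<^sup>2 \<le> w $ i * q $ i" and sq: "(\<Sum>i\<in>UNIV. q $ i) \<le> z"
    using assms by (auto simp: conic_lift_def)
  have "x $ i = w $ i * g $ i" for i
    using x[of i] by (cases "w $ i = 0") (auto simp: g_def)
  then show "x = w * g" by (simp add: vec_eq_iff)
  have "w $ i * (g $ i)\<^sup>2 \<le> q $ i" for i
  proof (cases "w $ i = 0")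
    case False
    then have "w $ i > 0" using capped_simplex_bounds(1)[OF w, of i] by simp
    then show ?thesis using x[of i] by (simp add: g_def power2_eq_square field_simps)
  qed (simp add: q)
  then have "weighted_square g w \<le> (\<Sum>i\<in>UNIV. q $ i)"
    unfolding weighted_square_def by (intro sum_mono)
  with sq show "weighted_square g w \<le> z" by simp
  show "w \<in> capped_simplex k" by (rule w)
qed

text \<open>
  A sparse vector \<open>x\<close> is certified by the indicator of its support with budgets \<open>x\<^sub>i\<^sup>2\<close>, and the
  certified vectors form a convex set, being a projection of the lift. Conversely, the slopes of a
  lifted point give a weighted representation of \<open>x\<close>.
\<close>
theorem convex_hull_sparse_ball:
  "convex hull sparse_ball k z = {x :: real ^ 'n. \<exists>w q. (w, q, x) \<in> conic_lift k z}"
proof (intro equalityI)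
  have eq: "{x :: real ^ 'n. \<exists>w q. (w, q, x) \<in> conic_lift k z} = (\<lambda>p. snd (snd p)) ` conic_lift k z"
    by force
  have "linear (\<lambda>p :: (real ^ 'n) \<times> (real ^ 'n) \<times> (real ^ 'n). snd (snd p))"
    by (rule linearI) auto
  then have conv: "convex {x :: real ^ 'n. \<exists>w q. (w, q, x) \<in> conic_lift k z}"
    unfolding eq by (rule convex_linear_image[OF _ convex_conic_lift])
  have "sparse_ball k z \<subseteq> {x :: real ^ 'n. \<exists>w q. (w, q, x) \<in> conic_lift k z}"
  proof
    fix x :: "real ^ 'n" assume x: "x \<in> sparse_ball k z"
    have "(\<Sum>i\<in>UNIV. if x $ i \<noteq> 0 then 1 else 0 :: real) = real (card {i. x $ i \<noteq> 0})"
      by (simp add: sum.If_cases)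
    then have "((\<chi> i. if x $ i \<noteq> 0 then 1 else 0), (\<chi> i. (x $ i)\<^sup>2), x) \<in> conic_lift k z"
      using x by (auto simp: conic_lift_def capped_simplex_def sparse_ball_def norm_vec_power2)
    then show "x \<in> {x. \<exists>w q. (w, q, x) \<in> conic_lift k z}" by blast
  qed
  then show "convex hull sparse_ball k z \<subseteq> {x :: real ^ 'n. \<exists>w q. (w, q, x) \<in> conic_lift k z}"
    using conv by (rule hull_minimal)
  show "{x :: real ^ 'n. \<exists>w q. (w, q, x) \<in> conic_lift k z} \<subseteq> convex hull sparse_ball k z"
    by (auto elim!: conic_lift_slopes intro!: weighted_in_hull_sparse_ball)
qed

section \<open>Low-rank optimal solutions\<close>

text \<open>
  With the slopes \<open>g\<close> fixed, \<open>A *v (v * g)\<close> is linear in the weights \<open>v\<close> and its range lies in the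
  range of \<open>A\<close>. Reoptimising the weights for the cost \<open>weighted_square g\<close> therefore yields weights
  whose support, which contains the support of \<open>v * g\<close>, is small.
\<close>
lemma sparsify_in_hull:
  fixes A :: "real ^ 'n ^ 'm"
  assumes x: "x \<in> convex hull sparse_ball k z"
  obtains x' where "x' \<in> convex hull sparse_ball k z" "A *v x' = A *v x"
    "card {i. x' $ i \<noteq> 0} \<le> k + rank A"
proof -
  obtain w q where "(w, q, x) \<in> conic_lift k z"
    using x unfolding convex_hull_sparse_ball by blast
  then obtain g where w: "w \<in> capped_simplex k" and xw: "x = w * g"
    and z: "weighted_square g w \<le> z" by (rule conic_lift_slopes)
  let ?L = "\<lambda>v. A *v (v * g)"
  have "linear ?L"
    using linear_compose[OF linear_times_right matrix_vector_mul_linear] by (simp add: o_def)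
  from sparse_solution_of_program[OF this linear_weighted_square w]
  obtain v where v: "v \<in> capped_simplex k" "?L v = ?L w"
      "weighted_square g v \<le> weighted_square g w"
      "card {i. v $ i \<noteq> 0} \<le> k + dim (range ?L)" by blast
  have "dim (range ?L) \<le> rank A"
    unfolding rank_dim_range by (intro dim_subset) auto
  moreover have "card {i. (v * g) $ i \<noteq> 0} \<le> card {i. v $ i \<noteq> 0}"
    by (intro card_mono) auto
  ultimately have "card {i. (v * g) $ i \<noteq> 0} \<le> k + rank A" using v(4) by simp
  moreover have "v * g \<in> convex hull sparse_ball k z"
    using v z by (intro weighted_in_hull_sparse_ball) auto
  ultimately show thesis using that v(2) xw by blast
qed

lemma srr_feasible_iff:
  "srr_feasible A b k (X, y, z) \<longleftrightarrow>
     0 \<le> z \<and> (\<exists>x \<in> convex hull sparse_ball k z. X = diag_mat x \<and> y = b - A *v x)"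
  by (auto simp: srr_feasible_def convex_hull_sparse_diag_set)

text \<open>
  The zero matrix with \<open>z = 0\<close> has objective value \<open>\<alpha> * R\<close>, so no feasible point with \<open>z > R\<close> can
  beat it. For \<open>z \<le> R\<close> all feasible points come from the compact lift at level \<open>R\<close>, on which the
  budget sum \<open>\<Sum> q\<^sub>i\<close> takes over the role of \<open>z\<close>.
\<close>
lemma srr_optimal_exists:
  fixes A :: "real ^ 'n ^ 'm"
  assumes "0 < \<alpha>"
  obtains X y z where "srr_optimal A b k \<alpha> (X, y, z)"
proof -
  define R where "R = (norm b)\<^sup>2 / (real CARD('n) * \<alpha>)"
  define f where "f = (\<lambda>(w :: real ^ 'n, q :: real ^ 'n, x :: real ^ 'n).
      1 / real CARD('n) * (norm (b - A *v x))\<^sup>2 + \<alpha> * (\<Sum>i\<in>UNIV. q $ i))"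
  have "0 \<le> R" using assms by (simp add: R_def)
  then have zero: "(0, 0, 0) \<in> conic_lift k R"
    by (simp add: conic_lift_def capped_simplex_def)
  have "continuous_on (conic_lift k R) (\<lambda>p. A *v snd (snd p))"
    by (rule linear_continuous_on_compose[OF _ matrix_vector_mul_linear]) (intro continuous_intros)
  then have "continuous_on (conic_lift k R) f"
    unfolding f_def case_prod_beta by (intro continuous_intros)
  with zero obtain p where p: "p \<in> conic_lift k R" "\<forall>p' \<in> conic_lift k R. f p \<le> f p'"
    using continuous_attains_inf[OF compact_conic_lift] by blast
  obtain w q x where p_eq: "p = (w, q, x)" by (metis prod_cases3)
  let ?z = "\<Sum>i\<in>UNIV. q $ i"
  have obj: "srr_objective \<alpha> (diag_mat x, b - A *v x, ?z) = f p"
    by (simp add: srr_objective_def f_def p_eq)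
  have "(w, q, x) \<in> conic_lift k ?z" "0 \<le> ?z"
    using p(1) by (auto simp: p_eq conic_lift_def intro!: sum_nonneg)
  then have feas: "srr_feasible A b k (diag_mat x, b - A *v x, ?z)"
    by (auto simp: srr_feasible_iff convex_hull_sparse_ball)
  have "f p \<le> srr_objective \<alpha> (X', y', z')" if "srr_feasible A b k (X', y', z')" for X' y' z'
  proof -
    from that obtain x' where x': "x' \<in> convex hull sparse_ball k z'" "y' = b - A *v x'"
      by (auto simp: srr_feasible_iff)
    show ?thesis
    proof (cases "z' \<le> R")
      case True
      obtain w' q' where l: "(w', q', x') \<in> conic_lift k z'"
        using x'(1) unfolding convex_hull_sparse_ball by blast
      then have "(w', q', x') \<in> conic_lift k R" using True by (auto simp: conic_lift_def)
      then have "f p \<le> f (w', q', x')" using p(2) by blast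
      also have "\<dots> \<le> srr_objective \<alpha> (X', y', z')"
        using l assms by (simp add: f_def srr_objective_def conic_lift_def x'(2))
      finally show ?thesis .
    next
      case False
      have "f p \<le> f (0, 0, 0)" using p(2) zero by blast
      also have "\<dots> = \<alpha> * R" using assms by (simp add: f_def R_def)
      also have "\<dots> \<le> \<alpha> * z'" using False assms by simp
      also have "\<dots> \<le> srr_objective \<alpha> (X', y', z')" by (simp add: srr_objective_def)
      finally show ?thesis .
    qed
  qed
  then have "srr_optimal A b k \<alpha> (diag_mat x, b - A *v x, ?z)"
    unfolding srr_optimal_def is_arg_min_linorder using feas obj by auto
  then show thesis by (rule that)
qed

theorem corollary6:
  fixes A :: "real ^ 'n ^ 'm" and b :: "real ^ 'm" and k :: nat and \<alpha> :: real
  assumes "1 \<le> k" and "k \<le> CARD('n)" and "0 < \<alpha>"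
  shows "\<exists>X y z. srr_optimal A b k \<alpha> (X, y, z) \<and> rank X \<le> k + rank A"
proof -
  obtain X y z where opt: "srr_optimal A b k \<alpha> (X, y, z)"
    using srr_optimal_exists[OF assms(3)] by blast
  then have "srr_feasible A b k (X, y, z)"
    by (simp add: srr_optimal_def is_arg_min_def)
  then obtain x where z: "0 \<le> z" and x: "x \<in> convex hull sparse_ball k z" "y = b - A *v x"
    by (auto simp: srr_feasible_iff)
  obtain x' where x': "x' \<in> convex hull sparse_ball k z" "A *v x' = A *v x"
      "card {i. x' $ i \<noteq> 0} \<le> k + rank A"
    using sparsify_in_hull[OF x(1)] by blast
  have "srr_feasible A b k (diag_mat x', y, z)"
    unfolding srr_feasible_iff using z x(2) x' by auto
  moreover have "srr_objective \<alpha> (diag_mat x', y, z) = srr_objective \<alpha> (X, y, z)"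
    by (simp add: srr_objective_def)
  ultimately have "srr_optimal A b k \<alpha> (diag_mat x', y, z)"
    using opt by (simp add: srr_optimal_def is_arg_min_def)
  moreover have "rank (diag_mat x') \<le> k + rank A"
    using x'(3) by (simp add: rank_diag_mat)
  ultimately show ?thesis by blast
qed

end
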